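(* Let $r\ge 4$, let $e\ge 3$ be any odd integer, $q=2^e$, and let $\mathcal{V}^r_\varepsilon\subset\mathrm{PG}(r,q^2)$ be the hypersurface defined in the context. Then the linear code $\mathcal{C}^r_\varepsilon=\mathcal{C}(\mathcal{V}^r_\varepsilon)$ over $\mathbb{F}_{q^2}$ generated by the $\mathbb{F}_{q^2}$-rational points of $\mathcal{V}^r_\varepsilon$ is an $(r+1)$-dimensional minimal code of length $|\mathcal{V}^r_\varepsilon|$.
   Context: Let $e\ge 3$ be odd, $q=2^e$, $r\ge 2$. Points of $\mathrm{PG}(r,q^2)$ (projective space of projective dimension $r$ over $\mathbb{F}_{q^2}$) have homogeneous coordinates $(X_0,\dots,X_r)$; $\Pi_\infty$ is the hyperplane $X_0=0$, and affine coordinates on the complement $\mathrm{AG}(r,q^2)$ are $x_i=X_i/X_0$. For an exponent involving $\sigma$, $\sigma$ stands for $2^{(e+1)/2}$, i.e. $x^{\sigma}=x^{2^{(e+1)/2}}$ and $x^{\sigma+2}=x^{2^{(e+1)/2}+2}$. Fix $\varepsilon\in\mathbb{F}_{q^2}\setminus\mathbb{F}_q$ such that $\varepsilon^2+\varepsilon+\delta=0$ for some $\delta\in\mathbb{F}_q\setminus\{1\}$ with absolute trace $\mathrm{Tr}_{q/2}(\delta)=\sum_{i=0}^{e-1}\delta^{2^i}=1$. Put $$\Gamma_{\varepsilon}(x)=[x+(x^q+x)\varepsilon]^{\sigma+2}+(x^q+x)^{\sigma}+(x^{2q}+x^2)\varepsilon+x^{q+1}+x^2.$$ $\mathcal{V}^r_\varepsilon$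 is the projective hypersurface of $\mathrm{PG}(r,q^2)$ with affine equation $x_r^q+x_r=\Gamma_{\varepsilon}(x_1)+\dots+\Gamma_{\varepsilon}(x_{r-1})$, i.e. the zero locus of the homogenization (with respect to $X_0$) of the corresponding polynomial; it is identified with its set of $\mathbb{F}_{q^2}$-rational points. For a set $\Omega$ of $N$ points of $\mathrm{PG}(r,q^2)$, $\mathcal{C}(\Omega)$ is the linear code of length $N$ over $\mathbb{F}_{q^2}$ spanned by the rows of an $(r+1)\times N$ matrix whose columns are coordinate vectors of the points of $\Omega$ (one representative per point); it is unique up to monomial equivalence. The support of a codeword $c=(c_1,\dots,c_N)$ is $\mathrm{supp}(c)=\{i: c_i\ne 0\}$. A codeword $c\in\mathcal{C}$ is minimal if every non-zero codeword $c'\in\mathcal{C}$ with $\mathrm{supp}(c')\subseteq\mathrm{supp}(c)$ is a scalar multiple of $c$. A linear code is minimal if all its non-zero codewords are minimal. *)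

theory Defs
  imports
    "HOL-Library.Cardinality"
    "HOL-Library.Poly_Mapping"
    "Jordan_Normal_Form.VS_Connect"
begin

section \<open>Multivariate polynomials\<close>

text \<open>Polynomials in the variables \<open>X 0, X 1, X 2, \<dots>\<close>: an exponent vector is a finitely supported
  map from indices to naturals, and the ring multiplication of \<^typ>\<open>'k \<Rightarrow>\<^sub>0 'a\<close> is convolution.\<close>

type_synonym 'a mpol = "(nat \<Rightarrow>\<^sub>0 nat) \<Rightarrow>\<^sub>0 'a"

definition mvar :: "nat \<Rightarrow> 'a::comm_ring_1 mpol" where
  "mvar i = Poly_Mapping.single (Poly_Mapping.single i 1) 1"

definition mconst :: "'a::comm_ring_1 \<Rightarrow> 'a mpol" where
  "mconst c = Poly_Mapping.single 0 c"

definition monom_degree :: "(nat \<Rightarrow>\<^sub>0 nat) \<Rightarrow> nat" where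
  "monom_degree m = (\<Sum>i\<in>Poly_Mapping.keys m. Poly_Mapping.lookup m i)"

definition total_degree :: "'a::comm_ring_1 mpol \<Rightarrow> nat" where
  "total_degree p = Max (insert 0 (monom_degree ` Poly_Mapping.keys p))"

definition homogenize :: "'a::comm_ring_1 mpol \<Rightarrow> 'a mpol" where
  "homogenize p =
     (\<Sum>m\<in>Poly_Mapping.keys p.
        Poly_Mapping.single (m + Poly_Mapping.single 0 (total_degree p - monom_degree m))
          (Poly_Mapping.lookup p m))"

definition eval_mpol :: "(nat \<Rightarrow> 'a) \<Rightarrow> 'a::comm_ring_1 mpol \<Rightarrow> 'a" where
  "eval_mpol x p =
     (\<Sum>m\<in>Poly_Mapping.keys p.
        Poly_Mapping.lookup p m * (\<Prod>i\<in>Poly_Mapping.keys m. x i ^ Poly_Mapping.lookup m i))"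


section \<open>Projective space\<close>

text \<open>A point is the set of all its coordinate vectors, i.e. of all non-zero multiples of one of
  them; the coordinates \<open>(X 0, \<dots>, X r)\<close> are the entries of a vector of dimension \<open>r + 1\<close>.\<close>

definition proj_point :: "'a::field vec \<Rightarrow> 'a vec set" where
  "proj_point v = {c \<cdot>\<^sub>v v | c. c \<noteq> 0}"

definition proj_space :: "nat \<Rightarrow> 'a::field vec set set" where
  "proj_space r = {proj_point v | v. v \<in> carrier_vec (r + 1) \<and> v \<noteq> 0\<^sub>v (r + 1)}"

definition proj_zeros :: "nat \<Rightarrow> 'a::field mpol \<Rightarrow> 'a vec set set" where
  "proj_zeros r p = {P \<in> proj_space r. \<forall>v\<in>P. eval_mpol (\<lambda>i. v $ i) p = 0}"


section \<open>The hypersurface\<close>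

text \<open>For \<open>q\<close> a power of the characteristic and a ground field of order \<open>q\<^sup>2\<close>, \<open>fixed_field q\<close> is
  the subfield of order \<open>q\<close>.\<close>

definition fixed_field :: "nat \<Rightarrow> 'a::field set" where
  "fixed_field q = {x. x ^ q = x}"

definition abs_trace :: "nat \<Rightarrow> 'a::field \<Rightarrow> 'a" where
  "abs_trace e x = (\<Sum>i<e. x ^ (2 ^ i))"

text \<open>Stated over an arbitrary commutative ring because it is applied to indeterminates.\<close>

definition Gamma :: "nat \<Rightarrow> 'b::comm_ring_1 \<Rightarrow> 'b \<Rightarrow> 'b" where
  "Gamma e eps x =
     (let q = 2 ^ e; \<sigma> = 2 ^ ((e + 1) div 2) in
        (x + (x ^ q + x) * eps) ^ (\<sigma> + 2) + (x ^ q + x) ^ \<sigma>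
        + (x ^ (2 * q) + x ^ 2) * eps + x ^ (q + 1) + x ^ 2)"

definition hypersurface_poly :: "nat \<Rightarrow> nat \<Rightarrow> 'a::field \<Rightarrow> 'a mpol" where
  "hypersurface_poly e r eps =
     mvar r ^ (2 ^ e) + mvar r - (\<Sum>i = 1..r - 1. Gamma e (mconst eps) (mvar i))"

definition hypersurface :: "nat \<Rightarrow> nat \<Rightarrow> 'a::field \<Rightarrow> 'a vec set set" where
  "hypersurface e r eps = proj_zeros r (homogenize (hypersurface_poly e r eps))"


section \<open>Codes\<close>

text \<open>The code of a point set depends on an ordering of the points and on a choice of coordinate
  vectors; \<open>coord_matrix r \<Omega> G\<close> says that the columns of \<open>G\<close> record such a choice.\<close>

definition coord_matrix :: "nat \<Rightarrow> 'a::field vec set set \<Rightarrow> 'a mat \<Rightarrow> bool" where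
  "coord_matrix r \<Omega> G \<longleftrightarrow>
     G \<in> carrier_mat (r + 1) (card \<Omega>) \<and>
     bij_betw (\<lambda>j. proj_point (col G j)) {..<card \<Omega>} \<Omega>"

lemma coord_matrix_exists:
  assumes "finite \<Omega>" and "\<Omega> \<subseteq> proj_space r"
  shows "\<exists>G. coord_matrix r \<Omega> G"
proof -
  obtain h where h: "bij_betw h {..<card \<Omega>} \<Omega>"
    using ex_bij_betw_nat_finite[OF assms(1)] by (auto simp: atLeast0LessThan)
  have "\<forall>P\<in>\<Omega>. \<exists>v. v \<in> carrier_vec (r + 1) \<and> proj_point v = P"
    using assms(2) unfolding proj_space_def by blast
  then obtain f where f: "\<forall>P\<in>\<Omega>. f P \<in> carrier_vec (r + 1) \<and> proj_point (f P) = P"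
    by metis
  define G where "G = mat_of_cols (r + 1) (map (\<lambda>j. f (h j)) [0..<card \<Omega>])"
  have "proj_point (col G j) = h j" if "j < card \<Omega>" for j
    using that f bij_betwE[OF h] unfolding G_def by simp
  then have "bij_betw (\<lambda>j. proj_point (col G j)) {..<card \<Omega>} \<Omega>"
    using h bij_betw_cong[of "{..<card \<Omega>}" "\<lambda>j. proj_point (col G j)" h \<Omega>] by simp
  moreover have "G \<in> carrier_mat (r + 1) (card \<Omega>)"
    unfolding G_def carrier_mat_def by simp
  ultimately show ?thesis
    unfolding coord_matrix_def by blast
qed

definition code :: "'a::field mat \<Rightarrow> 'a vec set" where
  "code G = vec_space.row_space (dim_col G) G"

definition linear_code :: "nat \<Rightarrow> 'a::field vec set \<Rightarrow> bool" where
  "linear_code N C \<longleftrightarrow> VectorSpace.subspace class_ring C (module_vec TYPE('a) N)"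

definition code_dim :: "nat \<Rightarrow> 'a::field vec set \<Rightarrow> nat" where
  "code_dim N C = vectorspace.dim class_ring ((module_vec TYPE('a) N)\<lparr>carrier := C\<rparr>)"

definition supp :: "'a::zero vec \<Rightarrow> nat set" where
  "supp c = {i. i < dim_vec c \<and> c $ i \<noteq> 0}"

definition minimal_codeword :: "'a::field vec set \<Rightarrow> 'a vec \<Rightarrow> bool" where
  "minimal_codeword C c \<longleftrightarrow>
     c \<in> C \<and>
     (\<forall>c'\<in>C. c' \<noteq> 0\<^sub>v (dim_vec c') \<and> supp c' \<subseteq> supp c \<longrightarrow> (\<exists>a. c' = a \<cdot>\<^sub>v c))"

definition minimal_code :: "'a::field vec set \<Rightarrow> bool" where
  "minimal_code C \<longleftrightarrow> (\<forall>c\<in>C. c \<noteq> 0\<^sub>v (dim_vec c) \<longrightarrow> minimal_codeword C c)"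

end

theory Submission
  imports Defs "Jordan_Normal_Form.DL_Rank" "HOL-Number_Theory.Residues"
begin

text \<open>A non-zero codeword is minimal iff the zeros of its linear form on the hypersurface span the whole
  hyperplane, so one has to show that every hyperplane section \<open>V \<inter> H\<close> spans \<open>H\<close>. Write
  \<open>x = s + t \<epsilon>\<close> with \<open>t = x\<^sup>q + x\<close> and \<open>s, t \<in> F\<close> for the subfield \<open>F\<close> of order \<open>q\<close>; then
  \<open>\<Gamma> x = s\<^sup>\<sigma>\<^sup>+\<^sup>2 + s t + t\<^sup>\<sigma>\<close> lies in \<open>F\<close>, the defining function of a Tits ovoid. At infinity the
  hypersurface is given by the leading form, which is a multiple of the sum of the \<open>X\<^sub>i\<^sup>\<sigma>\<^sup>+\<^sup>2\<close> at vectors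
  whose coordinates \<open>X\<^sub>1, \<dots>, X\<^sub>r\<^sub>-\<^sub>1\<close> are in \<open>F\<close>, with \<open>X\<^sub>r\<close> free. Since \<open>\<sigma>\<^sup>2 = 2\<close> as an
  automorphism of \<open>F\<close>, the map \<open>x \<mapsto> x\<^sup>\<sigma>\<^sup>+\<^sup>2\<close> is bijective on \<open>F\<close> but not additive; hence such
  points with three non-zero coordinates \<open>(1, a, b)\<close> already defeat every linear form in
  \<open>X\<^sub>1, \<dots>, X\<^sub>r\<^sub>-\<^sub>1\<close>, which is where \<open>r \<ge> 4\<close> enters. This settles the hyperplane at infinity and, together
  with one affine point, all hyperplanes that involve \<open>X\<^sub>r\<close>. On the remaining ones every affine point
  of the base lifts to \<open>V\<close>, because \<open>w \<mapsto> w\<^sup>q + w\<close> maps onto \<open>F\<close>.\<close>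

section \<open>Finite fields of characteristic two\<close>

lemma power_card_eq_self:
  fixes x :: "'a::{field,finite}"
  shows "x ^ CARD('a) = x"
proof (cases "x = 0")
  case False
  define P where "P = \<Prod>(UNIV - {0 :: 'a})"
  have "P \<noteq> 0"
    by (simp add: P_def)
  \<comment> \<open>Multiplication by \<open>x\<close> permutes the non-zero elements, so their
    product absorbs the factor \<open>x ^ (CARD('a) - 1)\<close> unchanged.\<close>
  have "bij_betw ((*) x) (UNIV - {0}) (UNIV - {0})"
    by (rule bij_betw_byWitness[where f' = "\<lambda>y. y / x"]) (use False in auto)
  then have "P = (\<Prod>y\<in>UNIV - {0}. x * y)"
    unfolding P_def using prod.reindex_bij_betw[of "(*) x" _ _ "\<lambda>y. y"] by metis
  also have "\<dots> = x ^ (CARD('a) - 1) * P"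
    by (simp add: prod.distrib P_def card_Diff_singleton)
  finally have "x ^ (CARD('a) - 1) = 1"
    using \<open>P \<noteq> 0\<close> by simp
  then show ?thesis
    by (simp add: power_eq_if[of x "CARD('a)"])
qed (simp add: zero_less_card_finite)

lemma CHAR_eq_2_if_card_power:
  assumes "CARD('a::{field,finite}) = 2 ^ n"
  shows "CHAR('a) = 2"
proof -
  have "prime CHAR('a)"
    by (rule prime_CHAR_semidom) (rule finite_imp_CHAR_pos, simp)
  moreover have "CHAR('a) dvd 2 ^ n"
    using CHAR_dvd_CARD[where ?'a = 'a] assms by simp
  ultimately show ?thesis
    by (meson prime_dvd_power primes_dvd_imp_eq two_is_prime_nat)
qed

lemma add_power_CHAR_2:
  fixes x y :: "'b::comm_ring_1"
  assumes "CHAR('b) = 2"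
  shows "(x + y) ^ 2 ^ n = x ^ 2 ^ n + y ^ 2 ^ n"
  using assms by (intro freshmans_dream') auto

section \<open>Evaluating homogenizations\<close>

text \<open>Linear in \<open>p\<close> for any weight. The weight \<open>eval_monom x m\<close>
  evaluates \<open>p\<close>; an extra factor \<open>x 0 ^ (D - monom_degree m)\<close> evaluates a
  homogenization without forming it.\<close>

definition weigh :: "((nat \<Rightarrow>\<^sub>0 nat) \<Rightarrow> 'a) \<Rightarrow> 'a::comm_ring_1 mpol \<Rightarrow> 'a" where
  "weigh w p = (\<Sum>m\<in>Poly_Mapping.keys p. Poly_Mapping.lookup p m * w m)"

definition eval_monom :: "(nat \<Rightarrow> 'a) \<Rightarrow> (nat \<Rightarrow>\<^sub>0 nat) \<Rightarrow> 'a::comm_ring_1" where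
  "eval_monom x m = (\<Prod>i\<in>Poly_Mapping.keys m. x i ^ Poly_Mapping.lookup m i)"

text \<open>Cancellation can remove keys from a sum of polynomials; a common index set keeps the
  sums comparable.\<close>

lemma weigh_superset:
  assumes "finite S" "Poly_Mapping.keys p \<subseteq> S"
  shows "weigh w p = (\<Sum>m\<in>S. Poly_Mapping.lookup p m * w m)"
  unfolding weigh_def using assms
  by (intro sum.mono_neutral_left) (auto simp: in_keys_iff)

lemma weigh_add: "weigh w (p + p') = weigh w p + weigh w p'"
proof -
  let ?S = "Poly_Mapping.keys p \<union> Poly_Mapping.keys p'"
  show ?thesis
    using weigh_superset[of ?S "p + p'" w] weigh_superset[of ?S p w] weigh_superset[of ?S p' w]
      Poly_Mapping.keys_add[of p p']
    by (simp add: lookup_add sum.distrib distrib_right)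
qed

lemma weigh_zero [simp]: "weigh w 0 = 0"
  by (simp add: weigh_def)

lemma weigh_single [simp]: "weigh w (Poly_Mapping.single m c) = c * w m"
  by (simp add: weigh_def)

lemma weigh_sum: "weigh w (\<Sum>i\<in>I. f i) = (\<Sum>i\<in>I. weigh w (f i))"
  by (induction I rule: infinite_finite_induct) (simp_all add: weigh_add)

lemma weigh_sum_list: "weigh w (sum_list ps) = sum_list (map (weigh w) ps)"
  by (induction ps) (simp_all add: weigh_add)

lemma eval_mpol_eq_weigh: "eval_mpol x p = weigh (eval_monom x) p"
  by (simp add: eval_mpol_def weigh_def eval_monom_def)

lemma eval_monom_superset:
  assumes "finite S" "Poly_Mapping.keys m \<subseteq> S"
  shows "eval_monom x m = (\<Prod>i\<in>S. x i ^ Poly_Mapping.lookup m i)"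
  unfolding eval_monom_def using assms
  by (intro prod.mono_neutral_left) (auto simp: in_keys_iff)

lemma eval_monom_add: "eval_monom x (m + m') = eval_monom x m * eval_monom x m'"
proof -
  let ?S = "Poly_Mapping.keys m \<union> Poly_Mapping.keys m'"
  show ?thesis
    using eval_monom_superset[of ?S "m + m'" x] eval_monom_superset[of ?S m x]
      eval_monom_superset[of ?S m' x] Poly_Mapping.keys_add[of m m']
    by (simp add: lookup_add prod.distrib power_add)
qed

lemma eval_monom_single [simp]: "eval_monom x (Poly_Mapping.single i n) = x i ^ n"
  by (simp add: eval_monom_def)

lemma monom_degree_single [simp]: "monom_degree (Poly_Mapping.single i n) = n"
  by (simp add: monom_degree_def)

lemma eval_monom_scale:
  "eval_monom (\<lambda>i. c * x i) m = c ^ monom_degree m * eval_monom x m"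
  by (simp add: eval_monom_def monom_degree_def power_mult_distrib prod.distrib power_sum)

text \<open>By linearity of \<open>weigh\<close> it does not matter whether monomials coincide after
  padding with powers of \<open>X 0\<close>.\<close>

lemma eval_homogenize:
  "eval_mpol x (homogenize p) =
     weigh (\<lambda>m. eval_monom x m * x 0 ^ (total_degree p - monom_degree m)) p"
  unfolding eval_mpol_eq_weigh homogenize_def weigh_sum weigh_single eval_monom_add
    eval_monom_single by (simp add: weigh_def)

lemma monom_degree_le_total_degree:
  "m \<in> Poly_Mapping.keys p \<Longrightarrow> monom_degree m \<le> total_degree p"
  unfolding total_degree_def by (rule Max_ge) auto

text \<open>Every padded monomial has degree exactly \<open>total_degree p\<close>. This makes
  vanishing independent of the coordinate vector of a point.\<close>

lemma eval_homogenize_scale: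
  "eval_mpol (\<lambda>i. c * x i) (homogenize p) = c ^ total_degree p * eval_mpol x (homogenize p)"
proof -
  have "c ^ total_degree p = c ^ monom_degree m * c ^ (total_degree p - monom_degree m)"
    if "m \<in> Poly_Mapping.keys p" for m
    using monom_degree_le_total_degree[OF that] by (simp flip: power_add)
  then show ?thesis
    unfolding eval_homogenize weigh_def sum_distrib_left
    by (intro sum.cong refl) (simp add: eval_monom_scale power_mult_distrib mult_ac)
qed

text \<open>The vector \<open>y\<close> witnesses that the component of degree \<open>D\<close> does not vanish, whence
  \<open>total_degree p = D\<close>.\<close>

lemma eval_homogenize_eq_if_le:
  assumes "\<And>m. m \<in> Poly_Mapping.keys p \<Longrightarrow> monom_degree m \<le> D"
    and "weigh (\<lambda>m. eval_monom y m * y 0 ^ (D - monom_degree m)) p \<noteq> 0" "y 0 = 0" "D > 0"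
  shows "eval_mpol x (homogenize p) = weigh (\<lambda>m. eval_monom x m * x 0 ^ (D - monom_degree m)) p"
proof -
  have "total_degree p \<le> D"
    unfolding total_degree_def using assms(1) by (intro Max.boundedI) auto
  moreover have "\<not> total_degree p < D"
  proof
    assume "total_degree p < D"
    then have "monom_degree m < D" if "m \<in> Poly_Mapping.keys p" for m
      using monom_degree_le_total_degree[OF that] by simp
    then have "y 0 ^ (D - monom_degree m) = 0" if "m \<in> Poly_Mapping.keys p" for m
      using that by (simp add: assms(3) power_0_left not_le)
    then show False
      using assms(2) by (simp add: weigh_def)
  qed
  ultimately show ?thesis
    by (simp add: eval_homogenize)
qed

section \<open>The hypersurface polynomial\<close>

text \<open>Natural numbers are constant polynomials, so they vanish in both rings simultaneously.
  Frobenius additivity then holds for indeterminates too.\<close>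

lemma mpol_CHAR: "CHAR('a::comm_ring_1 mpol) = CHAR('a)"
  by (rule CHAR_eqI)
    (auto simp flip: single_of_nat simp: of_nat_eq_0_iff_char_dvd 
      dest!: arg_cong[where f = "\<lambda>p. Poly_Mapping.lookup p 0"])

lemma mvar_power: "mvar i ^ n = Poly_Mapping.single (Poly_Mapping.single i n) 1"
  unfolding mvar_def by (induction n) (simp_all add: mult_single flip: Poly_Mapping.single_add)

lemma mconst_mult_single: "mconst c * Poly_Mapping.single m d = Poly_Mapping.single m (c * d)"
  by (simp add: mconst_def mult_single)

lemma mconst_one [simp]: "mconst 1 = 1"
  by (simp add: mconst_def)

lemma mconst_add: "mconst (a + b) = mconst a + mconst b"
  by (simp add: mconst_def single_add)

lemma mconst_mult: "mconst (a * b) = mconst a * mconst b"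
  by (simp add: mconst_def mult_single)

lemma mconst_power: "mconst (a ^ n) = mconst a ^ n"
  by (induction n) (simp_all add: mconst_mult)

text \<open>The monomial expansion of \<open>Gamma\<close> in characteristic two, leading term
  first. A list tolerates repeated exponents such as 2.\<close>

definition Gamma_terms :: "nat \<Rightarrow> 'b::comm_ring_1 \<Rightarrow> (nat \<times> 'b) list" where
  "Gamma_terms e eps =
     (let q = 2 ^ e; \<sigma> = 2 ^ ((e + 1) div 2) in
        [(q * (\<sigma> + 2), eps ^ (\<sigma> + 2)),
         (\<sigma> + 2, (1 + eps) ^ (\<sigma> + 2)),
         (2 * q + \<sigma>, (1 + eps) ^ \<sigma> * eps ^ 2),
         (q * \<sigma> + 2, eps ^ \<sigma> * (1 + eps) ^ 2),
         (q * \<sigma>, 1), (\<sigma>, 1), (2 * q, eps), (2, eps), (q + 1, 1), (2, 1)])"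

text \<open>Powers with exponents \<open>\<sigma>\<close> and 2 are additive, so the
  \<open>\<sigma> + 2\<close>-th power is a product of two binomials.\<close>

lemma Gamma_eq_Gamma_terms:
  fixes x :: "'b::comm_ring_1"
  assumes "CHAR('b) = 2"
  shows "Gamma e eps x = (\<Sum>(n, c)\<leftarrow>Gamma_terms e eps. c * x ^ n)"
proof -
  define q :: nat where "q = 2 ^ e"
  define \<sigma> :: nat where "\<sigma> = 2 ^ ((e + 1) div 2)"
  have pow_\<sigma>: "(y + z) ^ \<sigma> = y ^ \<sigma> + z ^ \<sigma>" for y z :: 'b
    unfolding \<sigma>_def by (rule add_power_CHAR_2[OF assms])
  have pow_2: "(y + z) ^ 2 = y ^ 2 + z ^ 2" for y z :: 'b
    using add_power_CHAR_2[OF assms, of y z 1] by simp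
  \<comment> \<open>All monomials are reduced to common atoms such as
    \<open>x ^ (q * \<sigma>)\<close> and \<open>(x ^ q) ^ 2\<close>, leaving plain ring
    arithmetic.\<close>
  have exps: "x ^ (2 * q) = (x ^ q) ^ 2" "x ^ (2 * q + \<sigma>) = (x ^ q) ^ 2 * x ^ \<sigma>"
    "x ^ (q * \<sigma> + 2) = x ^ (q * \<sigma>) * x ^ 2" "x ^ (q * (\<sigma> + 2)) = x ^ (q * \<sigma>) * (x ^ q) ^ 2"
    unfolding distrib_left power_add mult.commute[of q 2] power_even_eq by (simp_all only: mult.commute)
  have "x + (x ^ q + x) * eps = (1 + eps) * x + eps * x ^ q"
    by (simp add: algebra_simps)
  then have "(x + (x ^ q + x) * eps) ^ (\<sigma> + 2) =
      ((1 + eps) ^ \<sigma> * x ^ \<sigma> + eps ^ \<sigma> * x ^ (q * \<sigma>))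
        * ((1 + eps) ^ 2 * x ^ 2 + eps ^ 2 * (x ^ q) ^ 2)"
    unfolding power_add power_mult by (simp only: pow_\<sigma> pow_2 power_mult_distrib)
  moreover have "(x ^ q + x) ^ \<sigma> = x ^ (q * \<sigma>) + x ^ \<sigma>"
    by (simp add: pow_\<sigma> power_mult)
  ultimately show ?thesis
    unfolding Gamma_def Gamma_terms_def Let_def q_def[symmetric] \<sigma>_def[symmetric]
    by (simp only: exps power_add list.map sum_list.Cons sum_list.Nil prod.case)
      (simp add: distrib_left distrib_right ac_simps)
qed

lemma sum_list_0_if:
  "(\<And>y. y \<in> set ys \<Longrightarrow> f y = 0) \<Longrightarrow> (\<Sum>y\<leftarrow>ys. f y) = (0 :: 'b::comm_monoid_add)"
  by (induction ys) auto

lemma Gamma_mpol: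
  fixes eps :: "'a::comm_ring_1"
  assumes "CHAR('a) = 2"
  shows "Gamma e (mconst eps) (mvar i) =
    (\<Sum>(n, c)\<leftarrow>Gamma_terms e eps. Poly_Mapping.single (Poly_Mapping.single i n) c)"
proof -
  have "CHAR('a mpol) = 2"
    using assms by (simp add: mpol_CHAR)
  moreover have "Gamma_terms e (mconst eps) = map (\<lambda>(n, c). (n, mconst c)) (Gamma_terms e eps)"
    by (simp add: Gamma_terms_def Let_def mconst_add mconst_mult mconst_power)
  ultimately show ?thesis
    by (simp add: Gamma_eq_Gamma_terms mvar_power mconst_mult_single case_prod_unfold comp_def)
qed

lemma weigh_Gamma:
  fixes eps :: "'a::comm_ring_1"
  assumes "CHAR('a) = 2"
  shows "weigh w (Gamma e (mconst eps) (mvar i)) =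
    (\<Sum>(n, c)\<leftarrow>Gamma_terms e eps. c * w (Poly_Mapping.single i n))"
  by (simp add: Gamma_mpol[OF assms] weigh_sum_list comp_def case_prod_unfold)

lemma keys_sum_list: "Poly_Mapping.keys (sum_list ps) \<subseteq> (\<Union>p\<in>set ps. Poly_Mapping.keys p)"
  by (induction ps) (auto dest!: subsetD[OF Poly_Mapping.keys_add])

abbreviation hyp_degree :: "nat \<Rightarrow> nat" where
  "hyp_degree e \<equiv> 2 ^ e * (2 ^ ((e + 1) div 2) + 2)"

lemma Gamma_terms_degree:
  assumes "e \<ge> 1"
  shows "(n, c) \<in> set (tl (Gamma_terms e eps)) \<Longrightarrow> n < hyp_degree e"
proof -
  define q :: nat where "q = 2 ^ e"
  define \<sigma> :: nat where "\<sigma> = 2 ^ ((e + 1) div 2)"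
  have "q \<ge> 2" "\<sigma> \<ge> 2"
    unfolding q_def \<sigma>_def using assms self_le_power[of "2::nat"] by auto
  \<comment> \<open>Naming the product makes the comparison of exponents linear.\<close>
  moreover define p where "p = q * \<sigma>"
  ultimately have "2 * \<sigma> \<le> p" "2 * q \<le> p"
    by simp_all
  then show "(n, c) \<in> set (tl (Gamma_terms e eps)) \<Longrightarrow> n < hyp_degree e"
    unfolding Gamma_terms_def Let_def q_def[symmetric] \<sigma>_def[symmetric] distrib_left p_def[symmetric]
    using \<open>q \<ge> 2\<close> \<open>\<sigma> \<ge> 2\<close> by auto
qed

lemma Gamma_terms_eq_Cons:
  assumes "e \<ge> 1"
  obtains ts where "Gamma_terms e eps = (hyp_degree e, eps ^ (2 ^ ((e + 1) div 2) + 2)) # ts"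
    "\<And>n c. (n, c) \<in> set ts \<Longrightarrow> n < hyp_degree e"
proof
  show "Gamma_terms e eps = (hyp_degree e, eps ^ (2 ^ ((e + 1) div 2) + 2)) # tl (Gamma_terms e eps)"
    by (simp add: Gamma_terms_def Let_def)
qed (rule Gamma_terms_degree[OF assms])

lemma monom_degree_Gamma:
  fixes eps :: "'a::comm_ring_1"
  assumes "CHAR('a) = 2" "e \<ge> 1" "m \<in> Poly_Mapping.keys (Gamma e (mconst eps) (mvar i))"
  shows "monom_degree m \<le> hyp_degree e"
proof -
  obtain n c where "(n, c) \<in> set (Gamma_terms e eps)" "m = Poly_Mapping.single i n"
    using assms(3) unfolding Gamma_mpol[OF assms(1)]
    by (auto dest!: subsetD[OF keys_sum_list] split: if_splits)
  moreover obtain ts where "Gamma_terms e eps = (hyp_degree e, eps ^ (2 ^ ((e + 1) div 2) + 2)) # ts"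
    "\<And>n c. (n, c) \<in> set ts \<Longrightarrow> n < hyp_degree e"
    using Gamma_terms_eq_Cons[OF assms(2), of eps] by blast
  ultimately show ?thesis
    by (auto simp del: mult_Suc_right simp: less_imp_le)
qed

lemma hypersurface_poly_char2:
  assumes "CHAR('a::field) = 2"
  shows "hypersurface_poly e r (eps :: 'a) =
    mvar r ^ 2 ^ e + mvar r + (\<Sum>i = 1..r - 1. Gamma e (mconst eps) (mvar i))"
  using assms by (simp add: hypersurface_poly_def minus_CHAR_2 mpol_CHAR)

lemma monom_degree_hypersurface_poly:
  assumes "CHAR('a::field) = 2" "e \<ge> 1" "m \<in> Poly_Mapping.keys (hypersurface_poly e r (eps :: 'a))"
  shows "monom_degree m \<le> hyp_degree e"
proof -
  have "m \<in> Poly_Mapping.keys (mvar r ^ 2 ^ e :: 'a mpol) \<or> m \<in> Poly_Mapping.keys (mvar r ^ 1 :: 'a mpol)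
      \<or> (\<exists>i. m \<in> Poly_Mapping.keys (Gamma e (mconst eps) (mvar i)))"
    using assms(3) unfolding hypersurface_poly_char2[OF assms(1)] power_one_right
    by (auto dest!: subsetD[OF Poly_Mapping.keys_add] subsetD[OF keys_sum])
  then show ?thesis
    unfolding mvar_power using monom_degree_Gamma[OF assms(1,2)]
    by (auto split: if_splits simp: Suc_leI)
qed

lemma weigh_hypersurface_poly:
  fixes x :: "nat \<Rightarrow> 'a::field"
  assumes "CHAR('a) = 2"
  shows "weigh (\<lambda>m. eval_monom x m * x 0 ^ (D - monom_degree m)) (hypersurface_poly e r eps) =
    x r ^ 2 ^ e * x 0 ^ (D - 2 ^ e) + x r * x 0 ^ (D - 1)
    + (\<Sum>i = 1..r - 1. \<Sum>(n, c)\<leftarrow>Gamma_terms e eps. c * (x i ^ n * x 0 ^ (D - n)))"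
  unfolding hypersurface_poly_char2[OF assms] weigh_add weigh_sum weigh_Gamma[OF assms] mvar_power
  by (simp add: mvar_def)

lemma weigh_hypersurface_poly_affine:
  fixes x :: "nat \<Rightarrow> 'a::field"
  assumes "CHAR('a) = 2" "x 0 = 1"
  shows "weigh (\<lambda>m. eval_monom x m * x 0 ^ (D - monom_degree m)) (hypersurface_poly e r eps) =
    x r ^ 2 ^ e + x r + (\<Sum>i = 1..r - 1. Gamma e eps (x i))"
  unfolding weigh_hypersurface_poly[OF assms(1)] by (simp add: Gamma_eq_Gamma_terms assms)

text \<open>Terms of lower degree carry a positive power of \<open>x 0 = 0\<close>, so only the
  leading terms of \<open>Gamma\<close> survive.\<close>

lemma weigh_hypersurface_poly_infinity:
  fixes x :: "nat \<Rightarrow> 'a::field"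
  assumes "CHAR('a) = 2" "e \<ge> 1" "x 0 = 0"
  shows "weigh (\<lambda>m. eval_monom x m * x 0 ^ (hyp_degree e - monom_degree m)) (hypersurface_poly e r eps) =
    eps ^ (2 ^ ((e + 1) div 2) + 2) * (\<Sum>i = 1..r - 1. x i ^ hyp_degree e)"
proof -
  define D where "D = hyp_degree e"
  define c0 where "c0 = eps ^ (2 ^ ((e + 1) div 2) + 2)"
  obtain ts where ts: "Gamma_terms e eps = (D, c0) # ts" "\<And>n c. (n, c) \<in> set ts \<Longrightarrow> n < D"
    unfolding D_def c0_def using Gamma_terms_eq_Cons[OF assms(2), of eps] by blast
  have less: "x 0 ^ (D - n) = 0" if "n < D" for n
    using that by (simp add: assms(3) power_0_left)
  have "(\<Sum>(n, c)\<leftarrow>Gamma_terms e eps. c * (y ^ n * x 0 ^ (D - n))) = c0 * y ^ D" for y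
  proof -
    have "c * (y ^ n * x 0 ^ (D - n)) = 0" if "(n, c) \<in> set ts" for n c
      using less[OF ts(2)[OF that]] by (simp only: mult_zero_right)
    then have "(\<Sum>(n, c)\<leftarrow>ts. c * (y ^ n * x 0 ^ (D - n))) = 0"
      by (intro sum_list_0_if) auto
    then show ?thesis
      by (simp add: ts(1))
  qed
  \<comment> \<open>Both terms in \<open>x r\<close>, of degrees \<open>2 ^ e\<close> and 1, are of
    lower degree as well.\<close>
  moreover have "2 ^ e * 1 < D"
    unfolding D_def by (intro mult_strict_left_mono) auto
  moreover from this have "1 < D"
    using one_le_power[of "2 :: nat" e] by linarith
  ultimately show ?thesis
    unfolding weigh_hypersurface_poly[OF assms(1)] D_def[symmetric] c0_def[symmetric]
    by (simp add: sum_distrib_left less)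
qed

section \<open>Codes of cutting point sets\<close>

lemma mem_codeE:
  assumes "G \<in> carrier_mat (r + 1) N" "c \<in> code G"
  obtains y where "y \<in> carrier_vec (r + 1)" "c = G\<^sup>T *\<^sub>v y"
  using assms vec_space.row_space_eq[OF assms(1)] by (auto simp: code_def)

text \<open>The hypothesis \<open>cutting\<close> says that the points of \<open>\<Omega>\<close> on
  any hyperplane span it. Codewords are the value lists of linear forms, so containment of supports
  means that one form vanishes wherever the other does on \<open>\<Omega>\<close>.\<close>

lemma code_properties:
  fixes G :: "'a::field mat"
  assumes "coord_matrix r \<Omega> G" "r \<ge> 1"
    and cutting: "\<And>a b :: 'a vec. \<lbrakk>a \<in> carrier_vec (r + 1); b \<in> carrier_vec (r + 1); a \<noteq> 0\<^sub>v (r + 1);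
      \<And>v. \<lbrakk>v \<in> carrier_vec (r + 1); proj_point v \<in> \<Omega>; v \<bullet> a = 0\<rbrakk> \<Longrightarrow> v \<bullet> b = 0\<rbrakk>
      \<Longrightarrow> \<exists>k. b = k \<cdot>\<^sub>v a"
  shows "linear_code (card \<Omega>) (code G)" "code_dim (card \<Omega>) (code G) = r + 1" "minimal_code (code G)"
proof -
  define N where "N = card \<Omega>"
  have G: "G \<in> carrier_mat (r + 1) N" and "bij_betw (\<lambda>j. proj_point (col G j)) {..<N} \<Omega>"
    using assms(1) by (auto simp: coord_matrix_def N_def)
  then have points: "\<exists>j<N. proj_point (col G j) = P" if "P \<in> \<Omega>" for P
    using that by (auto simp: bij_betw_def image_iff)
  interpret vs: vec_space "TYPE('a)" N .
  have code: "code G = vs.span (set (cols G\<^sup>T))"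
    using G by (simp add: code_def vs.row_space_def)
  show "linear_code (card \<Omega>) (code G)"
    unfolding linear_code_def code N_def[symmetric]
    by (rule vs.span_is_subspace) (use G cols_dim[of "G\<^sup>T"] in auto)
  have entry: "(G\<^sup>T *\<^sub>v y) $ j = col G j \<bullet> y" if "j < N" for j y
    using that G by simp
  \<comment> \<open>Zeros on the columns carry over to any coordinate vector \<open>v\<close> of a
    point, since \<open>v\<close> is a multiple of a column.\<close>
  have vanish: "v \<bullet> y = 0"
    if zero: "\<And>j. \<lbrakk>j < N; (G\<^sup>T *\<^sub>v x) $ j = 0\<rbrakk> \<Longrightarrow> (G\<^sup>T *\<^sub>v y) $ j = 0"
      and v: "v \<in> carrier_vec (r + 1)" "proj_point v \<in> \<Omega>" "v \<bullet> x = 0"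
      and xy: "x \<in> carrier_vec (r + 1)" "y \<in> carrier_vec (r + 1)" for v x y
  proof -
    obtain j where j: "j < N" "proj_point (col G j) = proj_point v"
      using points v(2) by blast
    have col: "col G j \<in> carrier_vec (r + 1)"
      by (metis G carrier_matD(1) col_dim)
    have "v \<in> proj_point (col G j)"
      unfolding j(2) by (auto simp: proj_point_def intro!: exI[of _ 1])
    then obtain k where k: "k \<noteq> 0" "v = k \<cdot>\<^sub>v col G j"
      by (auto simp: proj_point_def)
    then show ?thesis
      using zero[OF j(1)] v(3) col xy by (simp only: entry[OF j(1)]) simp
  qed
  \<comment> \<open>A form vanishing on all of \<open>\<Omega>\<close> is a multiple of every
    non-zero form, in particular of two independent unit vectors.\<close>
  have inj: "y = 0\<^sub>v (r + 1)" if y: "y \<in> carrier_vec (r + 1)" "G\<^sup>T *\<^sub>v y = 0\<^sub>v N" for y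
  proof -
    have "\<exists>k. y = k \<cdot>\<^sub>v x" if x: "x \<in> carrier_vec (r + 1)" "x \<noteq> 0\<^sub>v (r + 1)" for x
      by (rule cutting[OF x(1) y(1) x(2)]) (rule vanish[of x y], use x y in auto)
    from this[of "unit_vec (r + 1) 0"] this[of "unit_vec (r + 1) 1"]
    have "\<exists>k. y = k \<cdot>\<^sub>v unit_vec (r + 1) 0" "\<exists>k. y = k \<cdot>\<^sub>v unit_vec (r + 1) 1"
      using assms(2) by auto
    then obtain k l where "y = k \<cdot>\<^sub>v unit_vec (r + 1) 0" "y = l \<cdot>\<^sub>v unit_vec (r + 1) 1"
      by blast
    then have "k = (l \<cdot>\<^sub>v unit_vec (r + 1) 1) $ 0"
      by (metis index_smult_vec(1) index_unit_vec(1) index_unit_vec(3) mult.right_neutral zero_less_Suc Suc_eq_plus1)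
    then have "k = 0"
      using assms(2) by simp
    then show ?thesis
      using \<open>y = k \<cdot>\<^sub>v unit_vec (r + 1) 0\<close> by auto
  qed
  have GT: "G\<^sup>T \<in> carrier_mat N (r + 1)"
    using G by simp
  \<comment> \<open>The rank argument uses the set of columns, so repetitions have to be excluded:
    equal rows of \<open>G\<close> would put a difference of unit vectors in the kernel.\<close>
  have "distinct (cols G\<^sup>T)"
  proof (rule ccontr)
    assume "\<not> distinct (cols G\<^sup>T)"
    then obtain i j where ij: "i < r + 1" "j < r + 1" "i \<noteq> j" "col G\<^sup>T i = col G\<^sup>T j"
      using GT by (auto simp: distinct_conv_nth)
    have "row G i = row G j"
      using ij G by simp
    then have "row G i $ k = row G j $ k" for k
      by simp
    then have entries: "G $$ (i, k) = G $$ (j, k)" if "k < N" for k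
      using that ij(1,2) G by (metis carrier_matD index_row(1))
    let ?y = "unit_vec (r + 1) i - unit_vec (r + 1) j :: 'a vec"
    have "G\<^sup>T *\<^sub>v ?y = G\<^sup>T *\<^sub>v unit_vec (r + 1) i - G\<^sup>T *\<^sub>v unit_vec (r + 1) j"
      using GT by (intro mult_minus_distrib_mat_vec) auto
    also have "\<dots> = 0\<^sub>v N"
      using ij GT by (intro eq_vecI) (auto simp: entries scalar_prod_right_unit)
    finally have "?y = 0\<^sub>v (r + 1)"
      by (intro inj) auto
    then have "?y $ i = 0\<^sub>v (r + 1) $ i"
      by simp
    then show False
      using ij by simp
  qed
  moreover from this have "vs.lin_indpt (set (cols G\<^sup>T))"
    using vs.lin_depE[OF GT] inj by metis
  ultimately show "code_dim (card \<Omega>) (code G) = r + 1"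
    using vs.lin_indpt_full_rank[OF GT] by (simp add: code_dim_def code vs.rank_def flip: N_def del: cols_transpose)
  show "minimal_code (code G)"
    unfolding minimal_code_def minimal_codeword_def
  proof (intro ballI impI conjI)
    fix c c'
    assume "c \<in> code G" "c' \<in> code G" and c: "c \<noteq> 0\<^sub>v (dim_vec c)"
      and c': "c' \<noteq> 0\<^sub>v (dim_vec c') \<and> supp c' \<subseteq> supp c"
    then obtain x y where x: "x \<in> carrier_vec (r + 1)" "c = G\<^sup>T *\<^sub>v x"
      and y: "y \<in> carrier_vec (r + 1)" "c' = G\<^sup>T *\<^sub>v y"
      using mem_codeE[OF G] by metis
    have "x \<noteq> 0\<^sub>v (r + 1)"
      using c x GT by auto
    moreover have "(G\<^sup>T *\<^sub>v y) $ j = 0" if "j < N" "(G\<^sup>T *\<^sub>v x) $ j = 0" for j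
      using that c' x y GT by (auto simp: supp_def simp del: index_mult_mat_vec)
    ultimately obtain k where "y = k \<cdot>\<^sub>v x"
      using cutting[OF x(1) y(1)] vanish[of x y] x y by metis
    then show "\<exists>k. c' = k \<cdot>\<^sub>v c"
      using x y GT by (auto simp: mult_mat_vec)
  qed
qed

section \<open>Membership of points in the hypersurface\<close>

lemma eval_homogenize_hypersurface_poly:
  fixes x :: "nat \<Rightarrow> 'a::field"
  assumes "CHAR('a) = 2" "e \<ge> 1" "r \<ge> 2" "eps \<noteq> 0"
  shows "eval_mpol x (homogenize (hypersurface_poly e r eps)) =
    weigh (\<lambda>m. eval_monom x m * x 0 ^ (hyp_degree e - monom_degree m)) (hypersurface_poly e r eps)"
proof (rule eval_homogenize_eq_if_le)
  \<comment> \<open>At this vector the leading form equals \<open>eps ^ (\<sigma> + 2)\<close>,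
    which is non-zero.\<close>
  let ?y = "\<lambda>i :: nat. if i = 1 then 1 else 0 :: 'a"
  have "(\<Sum>i = 1..r - 1. ?y i ^ hyp_degree e) = (\<Sum>i\<in>{1}. ?y i ^ hyp_degree e)"
    using assms(3) by (intro sum.mono_neutral_right) (auto simp: power_0_left)
  then have "(\<Sum>i = 1..r - 1. ?y i ^ hyp_degree e) = 1"
    by simp
  then show "weigh (\<lambda>m. eval_monom ?y m * ?y 0 ^ (hyp_degree e - monom_degree m)) (hypersurface_poly e r eps) \<noteq> 0"
    using weigh_hypersurface_poly_infinity[OF assms(1,2), of ?y r eps] assms(4) by simp
qed (use monom_degree_hypersurface_poly[OF assms(1,2)] in auto)

lemma proj_point_in_hypersurfaceI:
  fixes v :: "'a::field vec"
  assumes "CHAR('a) = 2" "e \<ge> 1" "r \<ge> 2" "eps \<noteq> 0" "v \<in> carrier_vec (r + 1)" "v \<noteq> 0\<^sub>v (r + 1)"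
    and zero: "weigh (\<lambda>m. eval_monom (($) v) m * v $ 0 ^ (hyp_degree e - monom_degree m)) (hypersurface_poly e r eps) = 0"
  shows "proj_point v \<in> hypersurface e r eps"
proof -
  let ?H = "homogenize (hypersurface_poly e r eps)"
  have "eval_mpol (($) (c \<cdot>\<^sub>v v)) ?H = 0" for c
  proof -
    \<comment> \<open>Scaling commutes with \<open>$\<close> only inside the dimension, so the
      explicit formula, which reads only the indices up to \<open>r\<close>, is used.\<close>
    have "(c \<cdot>\<^sub>v v) $ i = c * v $ i" if "i \<le> r" for i
      using that assms(5) by simp
    then have "eval_mpol (($) (c \<cdot>\<^sub>v v)) ?H = eval_mpol (\<lambda>i. c * v $ i) ?H"
      unfolding eval_homogenize_hypersurface_poly[OF assms(1-4)]
        weigh_hypersurface_poly[OF assms(1), of "($) (c \<cdot>\<^sub>v v)"]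
        weigh_hypersurface_poly[OF assms(1), of "\<lambda>i. c * v $ i"]
      by (intro arg_cong2[where f = "(+)"] sum.cong) auto
    also have "\<dots> = 0"
      unfolding eval_homogenize_scale
      using zero by (simp add: eval_homogenize_hypersurface_poly[OF assms(1-4)])
    finally show ?thesis .
  qed
  then show ?thesis
    using assms(5,6) by (auto simp: hypersurface_def proj_zeros_def proj_space_def proj_point_def)
qed

section \<open>The affine equation over the subfield\<close>

locale tits_setting =
  fixes e q \<sigma> :: nat and eps del :: "'a::{field,finite}"
  assumes e: "e \<ge> 3" "odd e"
    and q_def: "q = 2 ^ e" and \<sigma>_def: "\<sigma> = 2 ^ ((e + 1) div 2)"
    and card: "CARD('a) = q ^ 2"
    and eps_notin: "eps \<notin> fixed_field q"
    and del_in: "del \<in> fixed_field q"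
    and eps_root: "eps ^ 2 + eps + del = 0"
begin

abbreviation F :: "'a set" where
  "F \<equiv> fixed_field q"

text \<open>The relative trace onto \<open>F\<close>; on \<open>s + t * eps\<close> with
  \<open>s\<close>, \<open>t\<close> in \<open>F\<close> it reads off \<open>t\<close>.\<close>

definition tr :: "'a \<Rightarrow> 'a" where
  "tr x = x ^ q + x"

lemma CHAR_2: "CHAR('a) = 2"
  by (rule CHAR_eq_2_if_card_power[of "e * 2"]) (simp add: card q_def power_mult)

lemma add_self [simp]: "x + x = (0 :: 'a)"
  using uminus_CHAR_2[OF CHAR_2, of x] by (metis add.right_inverse)

lemma add_self_left [simp]: "x + (x + y) = (y :: 'a)"
  by (simp flip: add.assoc)

lemma add_eq_0_iff_eq: "x + y = (0 :: 'a) \<longleftrightarrow> x = y"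
  using uminus_CHAR_2[OF CHAR_2, of y] by (metis eq_neg_iff_add_eq_0)

lemma power_q_add: "(x + y) ^ q = x ^ q + (y ^ q :: 'a)"
  unfolding q_def by (rule add_power_CHAR_2[OF CHAR_2])

lemma power_\<sigma>_add: "(x + y) ^ \<sigma> = x ^ \<sigma> + (y ^ \<sigma> :: 'a)"
  unfolding \<sigma>_def by (rule add_power_CHAR_2[OF CHAR_2])

lemma power_2_add: "(x + y) ^ 2 = x ^ 2 + (y ^ 2 :: 'a)"
  using add_power_CHAR_2[OF CHAR_2, of x y 1] by simp

lemma power_q_power_q: "(x ^ q) ^ q = (x :: 'a)"
  using power_card_eq_self[of x] by (simp add: card power2_eq_square power_mult)

lemma q_ge_8: "q \<ge> 8"
  using power_increasing[OF e(1), of "2 :: nat"] by (simp add: q_def)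

lemma \<sigma>_ge_4: "\<sigma> \<ge> 4"
proof -
  have "2 \<le> (e + 1) div 2"
    using e(1) by simp
  from power_increasing[OF this, of "2 :: nat"] show ?thesis
    by (simp add: \<sigma>_def)
qed

text \<open>On \<open>F\<close>, where \<open>q\<close>-th powers are trivial, this says that
  applying \<open>\<sigma>\<close> twice is squaring.\<close>

lemma \<sigma>_\<sigma>: "\<sigma> * \<sigma> = 2 * q"
proof -
  have "(e + 1) div 2 + (e + 1) div 2 = e + 1"
    using e(2) by presburger
  then show ?thesis
    by (simp add: \<sigma>_def q_def flip: power_add)
qed

lemma F_iff: "x \<in> F \<longleftrightarrow> x ^ q = x"
  by (simp add: fixed_field_def)

lemma F_closed:
  "0 \<in> F" "1 \<in> F" "x \<in> F \<Longrightarrow> y \<in> F \<Longrightarrow> x + y \<in> F" "x \<in> F \<Longrightarrow> y \<in> F \<Longrightarrow> x * y \<in> F"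
  "x \<in> F \<Longrightarrow> x ^ n \<in> F"
proof -
  show "0 \<in> F" "1 \<in> F" "x \<in> F \<Longrightarrow> y \<in> F \<Longrightarrow> x + y \<in> F" "x \<in> F \<Longrightarrow> y \<in> F \<Longrightarrow> x * y \<in> F"
    using q_ge_8 by (simp_all add: F_iff power_q_add power_mult_distrib power_0_left)
  show "x ^ n \<in> F" if "x \<in> F"
    using that by (metis F_iff power_commutes power_mult mult.commute)
qed

lemma F_sum: "(\<And>i. i \<in> I \<Longrightarrow> f i \<in> F) \<Longrightarrow> sum f I \<in> F"
  by (induction I rule: infinite_finite_induct) (auto simp: F_closed)

lemma tr_in_F: "tr x \<in> F"
  by (simp add: F_iff tr_def power_q_add power_q_power_q add.commute)

lemma tr_add: "tr (x + y) = tr x + tr y"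
  by (simp add: tr_def power_q_add ac_simps)

lemma tr_mult_F: "a \<in> F \<Longrightarrow> tr (a * x) = a * tr x"
  by (simp add: tr_def F_iff power_mult_distrib distrib_left)

lemma tr_F: "a \<in> F \<Longrightarrow> tr a = 0"
  by (simp add: tr_def F_iff)

text \<open>Both \<open>eps\<close> and \<open>eps ^ q\<close> are roots of the same quadratic over
  \<open>F\<close>; adding the two equations shows that the trace is 0 or 1, and 0 would put
  \<open>eps\<close> into \<open>F\<close>.\<close>

lemma tr_eps: "tr eps = 1"
proof -
  have "(eps ^ 2 + eps + del) ^ q = 0"
    using q_ge_8 by (simp add: eps_root power_0_left)
  then have "(eps ^ q) ^ 2 + eps ^ q + del = 0"
    using del_in by (simp add: power_q_add F_iff flip: power_mult) (simp add: mult.commute)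
  then have "(eps ^ q) ^ 2 + eps ^ q + del + (eps ^ 2 + eps + del) = 0"
    by (simp add: eps_root)
  then have "tr eps * (tr eps + 1) = 0"
    by (simp add: tr_def power2_eq_square algebra_simps)
  moreover have "tr eps \<noteq> 0"
    using eps_notin by (simp add: F_iff tr_def add_eq_0_iff_eq)
  ultimately show ?thesis
    by (simp add: add_eq_0_iff_eq)
qed

lemma eps_neq_0: "eps \<noteq> 0"
  using eps_notin F_closed(1) by metis

lemma tr_combination: "s \<in> F \<Longrightarrow> t \<in> F \<Longrightarrow> tr (s + t * eps) = t"
  by (simp add: tr_add tr_F tr_mult_F tr_eps)

text \<open>This is the \<open>s\<close> in \<open>x = s + t * eps\<close>; its trace is zero, which
  in characteristic two means membership in \<open>F\<close>.\<close>

lemma first_coordinate_in_F: "x + tr x * eps \<in> F"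
proof -
  have "tr (x + tr x * eps) = 0"
    by (simp add: tr_add tr_mult_F[OF tr_in_F] tr_eps)
  then show ?thesis
    by (simp add: tr_def F_iff add_eq_0_iff_eq)
qed

section \<open>\<open>Gamma\<close> in coordinates over the subfield\<close>

lemma Gamma_eq:
  "Gamma e eps x = (x + tr x * eps) ^ (\<sigma> + 2) + (x + tr x * eps) * tr x + tr x ^ \<sigma>"
proof -
  \<comment> \<open>The terms \<open>tr x ^ 2 * eps\<close> and \<open>x * tr x\<close> combine to
    \<open>(x + tr x * eps) * tr x\<close>.\<close>
  have "x ^ (2 * q) + x ^ 2 = tr x ^ 2"
    by (simp add: tr_def power_2_add power_even_eq)
  moreover have "x ^ (q + 1) + x ^ 2 = x * tr x"
    by (simp add: tr_def power2_eq_square distrib_left)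
  ultimately show ?thesis
    unfolding Gamma_def Let_def q_def[symmetric] \<sigma>_def[symmetric] tr_def[symmetric] add.assoc
    by (simp add: distrib_left distrib_right power2_eq_square ac_simps)
qed

lemma Gamma_in_F: "Gamma e eps x \<in> F"
  unfolding Gamma_eq by (intro F_closed tr_in_F first_coordinate_in_F)

lemma Gamma_combination:
  assumes "s \<in> F" "t \<in> F"
  shows "Gamma e eps (s + t * eps) = s ^ (\<sigma> + 2) + s * t + t ^ \<sigma>"
  unfolding Gamma_eq tr_combination[OF assms] by (simp add: add.assoc)

section \<open>Power maps on the subfield\<close>

lemma power_\<sigma>_surj_F:
  assumes "y \<in> F"
  obtains t where "t \<in> F" "t ^ \<sigma> = y"
proof
  \<comment> \<open>Hence the \<open>\<sigma>\<close>-th power of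
    \<open>y ^ (\<sigma> div 2)\<close> is \<open>y ^ q = y\<close>.\<close>
  have "(\<sigma> div 2) * \<sigma> = q"
    using \<sigma>_\<sigma> by (simp add: \<sigma>_def e)
  then show "(y ^ (\<sigma> div 2)) ^ \<sigma> = y"
    using assms by (simp add: F_iff flip: power_mult)
qed (simp add: F_closed assms)

lemma power_\<sigma>_power_\<sigma>: "x \<in> F \<Longrightarrow> (x ^ \<sigma>) ^ \<sigma> = x ^ 2"
  by (simp add: \<sigma>_\<sigma> F_iff mult.commute[of 2] power_mult flip: power_mult[of x \<sigma> \<sigma>])

text \<open>From \<open>(\<sigma> + 2) * (\<sigma> - 2) + 4 = \<sigma> * \<sigma>\<close>, the
  \<open>\<sigma> - 2\<close>-th power of \<open>x ^ (\<sigma> + 2)\<close> is the inverse of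
  \<open>x ^ 2\<close> for non-zero \<open>x\<close>. So \<open>x ^ (\<sigma> + 2)\<close>
  determines \<open>x ^ 2\<close>, and thereby \<open>x\<close>.\<close>

lemma inj_on_power_\<sigma>_plus_2: "inj_on (\<lambda>x. x ^ (\<sigma> + 2)) F"
proof (rule inj_onI)
  have square: "(x ^ (\<sigma> + 2)) ^ (\<sigma> - 2) * x ^ 4 = x ^ 2" if "x \<in> F" for x :: 'a
  proof -
    \<comment> \<open>This avoids truncated subtraction.\<close>
    obtain k where "\<sigma> = 4 + k"
      using \<sigma>_ge_4 le_Suc_ex by blast
    then have "(\<sigma> + 2) * (\<sigma> - 2) + 4 = \<sigma> * \<sigma>"
      by (simp add: algebra_simps)
    then show ?thesis
      using power_\<sigma>_power_\<sigma>[OF that] by (metis power_add power_mult)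
  qed
  fix x y assume xy: "x \<in> F" "y \<in> F" "x ^ (\<sigma> + 2) = y ^ (\<sigma> + 2)"
  show "x = y"
  proof (cases "x = 0 \<or> y = 0")
    case True
    then show ?thesis
      using xy(3) by (auto simp: power_0_left)
  next
    case False
    define z where "z = (x ^ (\<sigma> + 2)) ^ (\<sigma> - 2)"
    have "z * x ^ 2 * x ^ 2 = 1 * x ^ 2" "z * y ^ 2 * y ^ 2 = 1 * y ^ 2"
      using square[OF xy(1)] square[OF xy(2)] xy(3) unfolding z_def
      by (simp_all flip: power_add add: mult.assoc)
    then have "z * x ^ 2 = 1" "z * y ^ 2 = 1"
      using False by (simp_all only: mult_cancel_right power_eq_0_iff) auto
    then have "x ^ 2 = y ^ 2"
      by (metis mult.left_commute mult.right_neutral)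
    then have "(x + y) ^ 2 = 0"
      by (simp add: power_2_add)
    then show ?thesis
      by (simp add: add_eq_0_iff_eq)
  qed
qed

text \<open>Otherwise the combinations \<open>s + t * eps\<close>, which exhaust the field, would
  number at most four.\<close>

lemma exists_F_not_0_1: "\<exists>a\<in>F. a \<noteq> 0 \<and> a \<noteq> 1"
proof (rule ccontr)
  assume "\<not> ?thesis"
  then have "F \<subseteq> {0, 1}"
    by auto
  have "UNIV \<subseteq> (\<lambda>(s, t). s + t * eps) ` (F \<times> F)"
  proof
    fix x
    have "x = (x + tr x * eps) + tr x * eps"
      by (simp add: add.assoc)
    then show "x \<in> (\<lambda>(s, t). s + t * eps) ` (F \<times> F)"
      using first_coordinate_in_F[of x] tr_in_F[of x] by force
  qed
  then have "CARD('a) \<le> card (F \<times> F)"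
    by (rule surj_card_le[rotated]) simp
  also have "\<dots> \<le> card ({0, 1 :: 'a} \<times> {0, 1 :: 'a})"
    using \<open>F \<subseteq> {0, 1}\<close> by (intro card_mono) auto
  finally have "q * q \<le> 4"
    by (simp add: card power2_eq_square card_cartesian_product)
  moreover have "8 * 8 \<le> q * q"
    using q_ge_8 by (intro mult_le_mono)
  ultimately show False
    by simp
qed

text \<open>Bijectivity provides \<open>b\<close> for any \<open>a\<close> outside 0 and 1. If
  \<open>b = 1 + a\<close>, expanding gives \<open>a ^ \<sigma> = a ^ 2\<close>; applying
  \<open>\<sigma>\<close> once more yields \<open>a ^ 2 = a ^ 4\<close>, forcing \<open>a\<close> to
  be 0 or 1.\<close>

lemma exists_off_line:
  obtains a b where "a \<in> F" "b \<in> F" "1 + a ^ (\<sigma> + 2) + b ^ (\<sigma> + 2) = 0" "1 + a + b \<noteq> 0"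
proof -
  obtain a where a: "a \<in> F" "a \<noteq> 0" "a \<noteq> 1"
    using exists_F_not_0_1 by blast
  have "(\<lambda>x. x ^ (\<sigma> + 2)) ` F = F"
    by (rule endo_inj_surj[OF _ _ inj_on_power_\<sigma>_plus_2]) (auto simp: F_closed)
  moreover have "1 + a ^ (\<sigma> + 2) \<in> F"
    by (intro F_closed a)
  ultimately obtain b where b: "b \<in> F" "b ^ (\<sigma> + 2) = 1 + a ^ (\<sigma> + 2)"
    by (metis (no_types, lifting) imageE)
  have "1 + a + b \<noteq> 0"
  proof
    assume "1 + a + b = 0"
    then have "b = 1 + a"
      by (simp add: add_eq_0_iff_eq)
    then have "(1 + a ^ \<sigma>) * (1 + a ^ 2) = 1 + a ^ \<sigma> * a ^ 2"
      using b(2) by (simp only: power_add power_\<sigma>_add power_2_add power_one)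
    then have "a ^ 2 + a ^ \<sigma> = 0"
      by (simp add: distrib_left distrib_right add.assoc)
        (metis add_self_left add.commute add.left_commute add_self)
    then have "a ^ \<sigma> = a ^ 2"
      by (simp add: add_eq_0_iff_eq)
    then have "a ^ 2 = (a ^ 2) ^ \<sigma>"
      using power_\<sigma>_power_\<sigma>[OF a(1)] by simp
    also have "\<dots> = (a ^ \<sigma>) ^ 2"
      by (simp add: mult.commute flip: power_mult)
    finally have "a ^ 4 = a ^ 2"
      using \<open>a ^ \<sigma> = a ^ 2\<close> by simp
    moreover have "(a * (a + 1)) ^ 2 = a ^ 4 + a ^ 2"
      unfolding distrib_left power_2_add by (simp add: power_mult_distrib flip: power_add)
    ultimately have "(a * (a + 1)) ^ 2 = 0"
      by simp
    then show False
      using a by (simp add: add_eq_0_iff_eq)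
  qed
  moreover have "1 + a ^ (\<sigma> + 2) + b ^ (\<sigma> + 2) = 0"
    unfolding b(2) by (rule add_self)
  ultimately show thesis
    using a(1) b(1) that by blast
qed

end

section \<open>Hyperplane sections\<close>

context tits_setting
begin

lemma affine_point_in_hypersurface:
  assumes "r \<ge> 2" "v \<in> carrier_vec (r + 1)" "v $ 0 = 1"
    and "tr (v $ r) = (\<Sum>i = 1..r - 1. Gamma e eps (v $ i))"
  shows "proj_point v \<in> hypersurface e r eps"
proof (rule proj_point_in_hypersurfaceI[OF CHAR_2 _ assms(1) eps_neq_0 assms(2)])
  show "weigh (\<lambda>m. eval_monom (($) v) m * v $ 0 ^ (hyp_degree e - monom_degree m))
      (hypersurface_poly e r eps) = 0"
    using assms(4) by (simp add: weigh_hypersurface_poly_affine[where x = "($) v", OF CHAR_2 assms(3)] tr_def flip: q_def)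
qed (use e assms(2,3) in auto)

lemma infinite_point_in_hypersurface:
  assumes "r \<ge> 2" "v \<in> carrier_vec (r + 1)" "v \<noteq> 0\<^sub>v (r + 1)" "v $ 0 = 0"
    and "\<And>i. i \<in> {1..r - 1} \<Longrightarrow> v $ i \<in> F" "(\<Sum>i = 1..r - 1. (v $ i) ^ (\<sigma> + 2)) = 0"
  shows "proj_point v \<in> hypersurface e r eps"
proof (rule proj_point_in_hypersurfaceI[OF CHAR_2 _ assms(1) eps_neq_0 assms(2,3)])
  \<comment> \<open>The factor \<open>q\<close> of the exponent acts trivially on
    \<open>F\<close>.\<close>
  have "(v $ i) ^ hyp_degree e = (v $ i) ^ (\<sigma> + 2)" if "i \<in> {1..r - 1}" for i
    using assms(5)[OF that] by (simp only: power_mult F_iff flip: q_def \<sigma>_def)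
  then have "(\<Sum>i = 1..r - 1. (v $ i) ^ hyp_degree e) = (\<Sum>i = 1..r - 1. (v $ i) ^ (\<sigma> + 2))"
    by (intro sum.cong refl)
  moreover have "e \<ge> 1"
    using e by simp
  ultimately show "weigh (\<lambda>m. eval_monom (($) v) m * v $ 0 ^ (hyp_degree e - monom_degree m))
      (hypersurface_poly e r eps) = 0"
    by (simp only: weigh_hypersurface_poly_infinity[where x = "($) v", OF CHAR_2 _ assms(4)] assms(6) mult_zero_right)
qed (use e in auto)

text \<open>The last coordinate does not occur in the leading form, so \<open>w\<close> is free;
  \<open>x\<close> or \<open>w\<close> being non-zero keeps \<open>v\<close> non-zero.\<close>

lemma infinite_point3_in_hypersurface:
  assumes "r \<ge> 2" "i \<in> {1..r - 1}" "j \<in> {1..r - 1}" "k \<in> {1..r - 1}" "i \<noteq> j" "j \<noteq> k" "i \<noteq> k"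
    and "x \<in> F" "y \<in> F" "z \<in> F" "x ^ (\<sigma> + 2) + y ^ (\<sigma> + 2) + z ^ (\<sigma> + 2) = 0" "x \<noteq> 0 \<or> w \<noteq> 0"
    and v: "v = x \<cdot>\<^sub>v unit_vec (r + 1) i + y \<cdot>\<^sub>v unit_vec (r + 1) j + z \<cdot>\<^sub>v unit_vec (r + 1) k
      + w \<cdot>\<^sub>v unit_vec (r + 1) r"
  shows "proj_point v \<in> hypersurface e r eps"
proof (rule infinite_point_in_hypersurface)
  have less: "i < r" "j < r" "k < r"
    using assms(1-4) by auto
  then have entry: "v $ l = (if l = i then x else 0) + (if l = j then y else 0)
      + (if l = k then z else 0) + (if l = r then w else 0)" if "l \<le> r" for l
    using that by (simp add: v)
  show "v $ 0 = 0" "\<And>l. l \<in> {1..r - 1} \<Longrightarrow> v $ l \<in> F"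
    using assms(1-10) by (auto simp: entry F_closed)
  have "v $ i = x" "v $ j = y" "v $ k = z" "v $ r = w"
    using assms(1-7) by (auto simp: entry)
  then show "v \<noteq> 0\<^sub>v (r + 1)"
    using assms(2,12) by auto
  have "(\<Sum>l = 1..r - 1. (v $ l) ^ (\<sigma> + 2)) = (\<Sum>l\<in>{i, j, k}. (v $ l) ^ (\<sigma> + 2))"
    using assms(1-7) \<sigma>_ge_4 by (intro sum.mono_neutral_right) (auto simp: entry power_0_left split: if_splits)
  also have "\<dots> = (v $ i) ^ (\<sigma> + 2) + (v $ j) ^ (\<sigma> + 2) + (v $ k) ^ (\<sigma> + 2)"
    using assms(5-7) by (simp add: add.assoc)
  also have "\<dots> = 0"
    by (simp only: \<open>v $ i = x\<close> \<open>v $ j = y\<close> \<open>v $ k = z\<close> assms(11))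
  finally show "(\<Sum>l = 1..r - 1. (v $ l) ^ (\<sigma> + 2)) = 0" .
qed (simp_all add: v assms(1))

text \<open>Points of shape (1, 1, 0) make the coefficients equal; a point off the line
  \<open>x + y + z = 0\<close> then makes the common value zero.\<close>

lemma linear_form_at_infinity_eq_0:
  fixes c :: "nat \<Rightarrow> 'a"
  assumes "r \<ge> 4"
    and zero: "\<And>i j k x y z. \<lbrakk>i \<in> {1..r - 1}; j \<in> {1..r - 1}; k \<in> {1..r - 1}; i \<noteq> j; j \<noteq> k; i \<noteq> k;
      x \<in> F; y \<in> F; z \<in> F; x ^ (\<sigma> + 2) + y ^ (\<sigma> + 2) + z ^ (\<sigma> + 2) = 0; x \<noteq> 0\<rbrakk>
      \<Longrightarrow> c i * x + c j * y + c k * z = 0"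
    and i: "i \<in> {1..r - 1}"
  shows "c i = 0"
proof -
  obtain j k where jk: "j \<in> {1..r - 1}" "k \<in> {1..r - 1}" "i \<noteq> j" "j \<noteq> k" "i \<noteq> k"
    using that[of 2 3] that[of 1 3] that[of 1 2] assms(1) i
    by (cases "i = 1"; cases "i = 2") auto
  have ci: "c i = c j" "c i = c k"
    using zero[OF i jk, of 1 1 0] zero[OF i jk(2,1), of 1 1 0] jk
    by (auto simp: F_closed add_eq_0_iff_eq)
  obtain a b where ab: "a \<in> F" "b \<in> F" "1 + a ^ (\<sigma> + 2) + b ^ (\<sigma> + 2) = 0" "1 + a + b \<noteq> 0"
    by (rule exists_off_line)
  have "c i * 1 + c j * a + c k * b = 0"
    by (rule zero[OF i jk F_closed(2) ab(1,2)]) (use ab(3) in simp_all)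
  then have "c i * (1 + a + b) = 0"
    by (simp add: distrib_left flip: ci)
  then show ?thesis
    using ab(4) by simp
qed

lemma hyperplane_section_cutting:
  fixes a b :: "'a vec"
  assumes "r \<ge> 4" and a: "a \<in> carrier_vec (r + 1)" and b: "b \<in> carrier_vec (r + 1)" and "a \<noteq> 0\<^sub>v (r + 1)"
    and zero: "\<And>v. \<lbrakk>v \<in> carrier_vec (r + 1); proj_point v \<in> hypersurface e r eps; v \<bullet> a = 0\<rbrakk> \<Longrightarrow> v \<bullet> b = 0"
  shows "\<exists>k. b = k \<cdot>\<^sub>v a"
proof -
  let ?u = "unit_vec (r + 1) :: nat \<Rightarrow> 'a vec"
  have r: "r \<ge> 2"
    using assms(1) by simp
  have at_infinity: "b $ i * x + b $ j * y + b $ k * z + b $ r * w = 0"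
    if "i \<in> {1..r - 1}" "j \<in> {1..r - 1}" "k \<in> {1..r - 1}" "i \<noteq> j" "j \<noteq> k" "i \<noteq> k"
      "x \<in> F" "y \<in> F" "z \<in> F" "x ^ (\<sigma> + 2) + y ^ (\<sigma> + 2) + z ^ (\<sigma> + 2) = 0" "x \<noteq> 0 \<or> w \<noteq> 0"
      "a $ i * x + a $ j * y + a $ k * z + a $ r * w = 0" for i j k x y z w
  proof -
    let ?v = "x \<cdot>\<^sub>v ?u i + y \<cdot>\<^sub>v ?u j + z \<cdot>\<^sub>v ?u k + w \<cdot>\<^sub>v ?u r"
    have less: "i < r" "j < r" "k < r"
      using that(1-3) r by auto
    have "?v \<bullet> c = c $ i * x + c $ j * y + c $ k * z + c $ r * w" if "c \<in> carrier_vec (r + 1)" for c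
      using that less by (simp add: add_scalar_prod_distrib[of _ "r + 1"] mult.commute)
    then show ?thesis
      using zero[of ?v] infinite_point3_in_hypersurface[OF r that(1-11) refl] that(12) a b by simp
  qed
  have affine: "b $ 0 + b $ i * x + b $ j * y + b $ r * w = 0"
    if "i \<in> {1..r - 1}" "j \<in> {1..r - 1}" "i \<noteq> j"
      "tr w = (\<Sum>l = 1..r - 1. Gamma e eps ((x \<cdot>\<^sub>v ?u i + y \<cdot>\<^sub>v ?u j) $ l))"
      "a $ 0 + a $ i * x + a $ j * y + a $ r * w = 0" for i j x y w
  proof -
    let ?v = "?u 0 + x \<cdot>\<^sub>v ?u i + y \<cdot>\<^sub>v ?u j + w \<cdot>\<^sub>v ?u r"
    have less: "i < r" "j < r"
      using that(1,2) r by auto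
    have "?v \<bullet> c = c $ 0 + c $ i * x + c $ j * y + c $ r * w" if "c \<in> carrier_vec (r + 1)" for c
      using that less by (simp add: add_scalar_prod_distrib[of _ "r + 1"] mult.commute)
    moreover have "proj_point ?v \<in> hypersurface e r eps"
    proof (rule affine_point_in_hypersurface[OF r])
      have "?v $ r = w"
        using that(1-3) r by auto
      moreover have "(\<Sum>l = 1..r - 1. Gamma e eps (?v $ l)) =
          (\<Sum>l = 1..r - 1. Gamma e eps ((x \<cdot>\<^sub>v ?u i + y \<cdot>\<^sub>v ?u j) $ l))"
        using that(1-3) r by (intro sum.cong refl arg_cong[where f = "Gamma e eps"]) auto
      ultimately show "tr (?v $ r) = (\<Sum>l = 1..r - 1. Gamma e eps (?v $ l))"
        using that(4) by simp
    qed (use that(1-3) r in auto)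
    ultimately show ?thesis
      using zero[of ?v] that(5) a b by simp
  qed
  have vec_eqI: "b = k \<cdot>\<^sub>v a" if "b $ 0 = k * a $ 0" "b $ r = k * a $ r"
    "\<And>i. i \<in> {1..r - 1} \<Longrightarrow> b $ i = k * a $ i" for k
  proof (rule eq_vecI)
    fix i assume "i < dim_vec (k \<cdot>\<^sub>v a)"
    then have "i = 0 \<or> i = r \<or> i \<in> {1..r - 1}"
      using a by auto
    then show "b $ i = (k \<cdot>\<^sub>v a) $ i"
      using that a by auto
  qed (use a b in simp)
  \<comment> \<open>The hyperplane involves the last coordinate, or it omits it but is not at
    infinity, or it is the hyperplane at infinity.\<close>
  consider "a $ r \<noteq> 0" | j where "a $ r = 0" "j \<in> {1..r - 1}" "a $ j \<noteq> 0"
    | "a $ r = 0" "\<And>j. j \<in> {1..r - 1} \<Longrightarrow> a $ j = 0"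
    by blast
  then show ?thesis
  proof cases
    case 1
    define k where "k = b $ r / a $ r"
    have br: "b $ r = k * a $ r"
      using 1 by (simp add: k_def)
    have "b $ i - k * a $ i = 0" if "i \<in> {1..r - 1}" for i
    proof (rule linear_form_at_infinity_eq_0[OF assms(1) _ that])
      fix i j l x y z
      assume *: "i \<in> {1..r - 1}" "j \<in> {1..r - 1}" "l \<in> {1..r - 1}" "i \<noteq> j" "j \<noteq> l" "i \<noteq> l"
        "x \<in> F" "y \<in> F" "z \<in> F" "x ^ (\<sigma> + 2) + y ^ (\<sigma> + 2) + z ^ (\<sigma> + 2) = 0" "x \<noteq> 0"
      \<comment> \<open>The free last coordinate is used to put the point on the hyperplane; there
        \<open>b - k * a\<close> only involves the other coordinates.\<close>
      define w where "w = - (a $ i * x + a $ j * y + a $ l * z) / a $ r"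
      have "b $ i * x + b $ j * y + b $ l * z + b $ r * w = 0"
        by (rule at_infinity[OF *(1-10)]) (use *(11) 1 in \<open>auto simp: w_def\<close>)
      moreover have "a $ r * w = - (a $ i * x + a $ j * y + a $ l * z)"
        using 1 by (simp add: w_def)
      then have bw: "b $ r * w = k * - (a $ i * x + a $ j * y + a $ l * z)"
        by (simp only: br mult.assoc)
      have "(b $ i - k * a $ i) * x + (b $ j - k * a $ j) * y + (b $ l - k * a $ l) * z =
          b $ i * x + b $ j * y + b $ l * z + b $ r * w"
        unfolding bw by (simp add: algebra_simps)
      ultimately show "(b $ i - k * a $ i) * x + (b $ j - k * a $ j) * y + (b $ l - k * a $ l) * z = 0"
        by simp
    qed
    then have bi: "b $ i = k * a $ i" if "i \<in> {1..r - 1}" for i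
      using that by auto
    text \<open>With \<open>w = c + d x\<close> and \<open>x = s + t \<epsilon>\<close>, the choice \<open>s = tr (d \<epsilon>)\<close> cancels the terms linear
      in \<open>t\<close> of the affine equation \<open>tr w = \<Gamma> x\<close>, which then only prescribes \<open>t\<^sup>\<sigma>\<close>.\<close>
    define c where "c = - a $ 0 / a $ r"
    define d where "d = - a $ 1 / a $ r"
    define s where "s = tr (d * eps)"
    have s: "s \<in> F"
      by (simp add: s_def tr_in_F)
    obtain t where t: "t \<in> F" "t ^ \<sigma> = s ^ (\<sigma> + 2) + s * tr d + tr c"
      by (rule power_\<sigma>_surj_F[of "s ^ (\<sigma> + 2) + s * tr d + tr c"]) (intro F_closed s tr_in_F)
    define x where "x = s + t * eps"
    define w where "w = c + d * x"
    have "tr w = tr (c + (s * d + t * (d * eps)))"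
      by (simp add: w_def x_def algebra_simps)
    also have "\<dots> = tr c + (s * tr d + t * s)"
      by (simp only: tr_add tr_mult_F[OF s] tr_mult_F[OF t(1)] flip: s_def)
    also have "\<dots> = Gamma e eps x"
      unfolding x_def Gamma_combination[OF s t(1)] t(2) by (simp add: ac_simps)
    also have "Gamma e eps x = (\<Sum>l\<in>{1}. Gamma e eps ((x \<cdot>\<^sub>v ?u 1 + 0 \<cdot>\<^sub>v ?u 2) $ l))"
      using r by simp
    \<comment> \<open>The remaining coordinates are 0, where \<open>Gamma\<close> vanishes.\<close>
    also have "\<dots> = (\<Sum>l = 1..r - 1. Gamma e eps ((x \<cdot>\<^sub>v ?u 1 + 0 \<cdot>\<^sub>v ?u 2) $ l))"
      using r Gamma_combination[OF F_closed(1,1)] \<sigma>_ge_4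
      by (intro sum.mono_neutral_left) (auto simp: power_0_left split: if_splits)
    finally have "b $ 0 + b $ 1 * x + b $ 2 * 0 + b $ r * w = 0"
      by (rule affine[rotated 3]) (use assms(1) 1 in \<open>auto simp: w_def c_def d_def field_simps\<close>)
    \<comment> \<open>Apart from index 0, \<open>b\<close> is already \<open>k * a\<close>, so this
      one affine point determines \<open>b $ 0\<close>.\<close>
    moreover have "a $ 0 + a $ 1 * x + a $ r * w = 0"
      using 1 by (simp add: w_def c_def d_def field_simps)
    then have "k * a $ 0 + k * a $ 1 * x + k * a $ r * w = 0"
      by (metis distrib_left mult.assoc mult_zero_right)
    ultimately have "b $ 0 = k * a $ 0"
      using bi[of 1] br r by (simp add: add_eq_0_iff_eq add.assoc)
    then show ?thesis
      using vec_eqI br bi by blast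
  next
    case (2 j)
    define k where "k = b $ j / a $ j"
    have lift: "b $ 0 + b $ i * x + b $ j * y = 0" "b $ r = 0"
      if ij: "i \<in> {1..r - 1}" "i \<noteq> j" and on: "a $ 0 + a $ i * x + a $ j * y = 0" for i x y
    proof -
      let ?g = "\<Sum>l = 1..r - 1. Gamma e eps ((x \<cdot>\<^sub>v ?u i + y \<cdot>\<^sub>v ?u j) $ l)"
      have g: "?g \<in> F"
        by (intro F_sum Gamma_in_F)
      \<comment> \<open>Every \<open>s\<close> in \<open>F\<close> lifts the same base point, as
        \<open>s + ?g * eps\<close> has trace \<open>?g\<close>.\<close>
      have eq: "b $ 0 + b $ i * x + b $ j * y + b $ r * (s + ?g * eps) = 0" if "s \<in> F" for s
        by (rule affine[OF ij(1) 2(2) ij(2) tr_combination[OF that g]]) (use on 2(1) in simp)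
      \<comment> \<open>Two lifts differing by 1 in the last coordinate isolate
        \<open>b $ r\<close>.\<close>
      have "b $ r = (b $ 0 + b $ i * x + b $ j * y + b $ r * (1 + ?g * eps))
          - (b $ 0 + b $ i * x + b $ j * y + b $ r * (0 + ?g * eps))"
        by (simp only: distrib_left) simp
      then show "b $ r = 0"
        by (simp only: eq[OF F_closed(1)] eq[OF F_closed(2)] diff_self)
      with eq[OF F_closed(1)] show "b $ 0 + b $ i * x + b $ j * y = 0"
        by simp
    qed
    obtain i0 where i0: "i0 \<in> {1..r - 1}" "i0 \<noteq> j"
      using that[of 1] that[of 2] assms(1) by (cases "j = 1") auto
    have b0: "b $ 0 = k * a $ 0" and br: "b $ r = 0"
      using lift[OF i0, of 0 "- a $ 0 / a $ j"] 2(3) by (auto simp: k_def field_simps)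
    have "b $ i = k * a $ i" if "i \<in> {1..r - 1}" for i
    proof (cases "i = j")
      case True
      then show ?thesis
        using 2(3) by (simp add: k_def)
    next
      case False
      \<comment> \<open>Solves the hyperplane equation for the base point with 1 at index
        \<open>i\<close>.\<close>
      define y where "y = - (a $ 0 + a $ i) / a $ j"
      have "b $ 0 + b $ i * 1 + b $ j * y = 0"
        by (rule lift(1)[OF that False]) (use 2(3) in \<open>simp add: y_def\<close>)
      moreover have "b $ j * y = k * - (a $ 0 + a $ i)"
        using 2(3) by (simp add: k_def y_def)
      moreover have "b $ i - k * a $ i = k * a $ 0 + b $ i * 1 + k * - (a $ 0 + a $ i)"
        by (simp add: algebra_simps)
      ultimately have "b $ i - k * a $ i = 0"
        by (simp only: b0)
      then show ?thesis
        by simp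
    qed
    then show ?thesis
      using 2(1) by (intro exI[of _ k] vec_eqI) (simp_all add: b0 br)
  next
    case 3
    have "b $ i = 0" if "i \<in> {1..r - 1}" for i
      by (rule linear_form_at_infinity_eq_0[OF assms(1) _ that])
        (use at_infinity[where w = 0] 3 in auto)
    \<comment> \<open>The point with only its last coordinate non-zero lies on the
      hypersurface.\<close>
    moreover have "b $ r = 0"
      using at_infinity[of 1 2 3 0 0 0 1] assms(1) 3 \<sigma>_ge_4 by (simp add: F_closed power_0_left)
    moreover have "a $ 0 \<noteq> 0"
    proof
      assume "a $ 0 = 0"
      have "a = 0\<^sub>v (r + 1)"
      proof (rule eq_vecI)
        fix i assume "i < dim_vec (0\<^sub>v (r + 1) :: 'a vec)"
        then have "i = 0 \<or> i = r \<or> i \<in> {1..r - 1}"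
          by auto
        then show "a $ i = 0\<^sub>v (r + 1) $ i"
          using 3 \<open>a $ 0 = 0\<close> by auto
      qed (use a in simp)
      then show False
        using assms(4) by simp
    qed
    ultimately show ?thesis
      using 3 by (intro exI[of _ "b $ 0 / a $ 0"] vec_eqI) simp_all
  qed
qed

end

theorem theorem3p12:
  fixes r e q :: nat
    and \<epsilon> \<delta> :: "'a::{field,finite}"
    and G :: "'a mat"
  assumes "r \<ge> 4"
    and "e \<ge> 3" and "odd e" and "q = 2 ^ e"
    and "CARD('a) = q ^ 2"
    and "\<epsilon> \<notin> fixed_field q"
    and "\<delta> \<in> fixed_field q - {1}"
    and "abs_trace e \<delta> = 1"
    and "\<epsilon> ^ 2 + \<epsilon> + \<delta> = 0"
    and "coord_matrix r (hypersurface e r \<epsilon>) G"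
  shows "linear_code (card (hypersurface e r \<epsilon>)) (code G)
    \<and> code_dim (card (hypersurface e r \<epsilon>)) (code G) = r + 1
    \<and> minimal_code (code G)"
proof -
  interpret tits_setting e q "2 ^ ((e + 1) div 2)" \<epsilon> \<delta>
    by standard (use assms in auto)
  have "r \<ge> 1"
    using assms(1) by simp
  then show ?thesis
    using code_properties[OF assms(10) _ hyperplane_section_cutting[OF assms(1)]] by blast
qed

end
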